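(* Let $k\geq 2$. Let $\mathcal{R}$ be a set of $n$ axis-parallel rectangles in the plane, and let $H=H(\mathcal{R})$. Then $f_H(k-1)=O(k\log^2 n)$.
   Context: For a finite family $\mathcal{R}$ of regions in $\mathbb{R}^2$ and a point $p$, let $r(p)=\{R\in\mathcal{R}: p\in R\}$. The hypergraph induced by $\mathcal{R}$ is $H(\mathcal{R})=(\mathcal{R},\{r(p)\}_{p\in\mathbb{R}^2})$. $k$-Strong-Conflict-Free ($k$SCF) coloring of a hypergraph: a coloring of the vertices such that (i) every hyperedge $e$ with $|e|\geq k$ contains at least $k$ vertices each of whose color is unique among the colors of vertices of $e$, and (ii) every hyperedge $e$ with $|e|<k$ has all its vertices colored distinctly. $f_H(k)$ is the least number of colors in a $k$SCF-coloring of $H$. The implied constant is absolute. *)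

theory Defs
  imports Complex_Main
begin

text \<open>A hypergraph is a pair (vertex set, set of hyperedges).\<close>

type_synonym 'a hypergraph = "'a set \<times> 'a set set"

definition regions_at :: "'p set set \<Rightarrow> 'p \<Rightarrow> 'p set set" where
  "regions_at R p = {A \<in> R. p \<in> A}"

definition induced_hypergraph :: "'p set set \<Rightarrow> 'p set hypergraph" where
  "induced_hypergraph R = (R, range (regions_at R))"

definition uniquely_coloured :: "('a \<Rightarrow> 'c) \<Rightarrow> 'a set \<Rightarrow> 'a set" where
  "uniquely_coloured c e = {v \<in> e. \<forall>w\<in>e. c w = c v \<longrightarrow> w = v}"

definition scf_coloring :: "nat \<Rightarrow> 'a hypergraph \<Rightarrow> ('a \<Rightarrow> 'c) \<Rightarrow> bool" where
  "scf_coloring k H c \<longleftrightarrow>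
     (\<forall>e \<in> snd H. k \<le> card e \<longrightarrow> k \<le> card (uniquely_coloured c e)) \<and>
     (\<forall>e \<in> snd H. card e < k \<longrightarrow> inj_on c e)"

text \<open>
  Only meaningful for hypergraphs with a finite vertex set; there the least element exists,
  since an injective coloring is always a strong conflict-free one (see below).
\<close>

definition scf_number :: "'a hypergraph \<Rightarrow> nat \<Rightarrow> nat" where
  "scf_number H k =
     (LEAST m. \<exists>c :: 'a \<Rightarrow> nat. scf_coloring k H c \<and> card (c ` fst H) = m)"

definition axis_parallel_rectangle :: "(real \<times> real) set \<Rightarrow> bool" where
  "axis_parallel_rectangle A \<longleftrightarrow>
     (\<exists>a b c d. a < b \<and> c < d \<and> A = {a..b} \<times> {c..d})"

lemma scf_coloring_inj:
  assumes "inj_on c (fst H)" and "\<And>e. e \<in> snd H \<Longrightarrow> e \<subseteq> fst H"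
  shows "scf_coloring k H c"
proof -
  have inj: "inj_on c e" if "e \<in> snd H" for e
    using assms that inj_on_subset by blast
  then have "uniquely_coloured c e = e" if "e \<in> snd H" for e
    using that by (auto simp: uniquely_coloured_def dest: inj_onD)
  with inj show ?thesis
    by (simp add: scf_coloring_def)
qed

lemma scf_number_attained:
  fixes H :: "'a hypergraph"
  assumes "finite (fst H)" and "\<And>e. e \<in> snd H \<Longrightarrow> e \<subseteq> fst H"
  shows "\<exists>c :: 'a \<Rightarrow> nat. scf_coloring k H c \<and> card (c ` fst H) = scf_number H k"
proof -
  obtain c :: "'a \<Rightarrow> nat" where "inj_on c (fst H)"
    using finite_imp_inj_to_nat_seg[OF assms(1)] by blast
  then have "\<exists>m. \<exists>c :: 'a \<Rightarrow> nat. scf_coloring k H c \<and> card (c ` fst H) = m"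
    using scf_coloring_inj[of c H k] assms(2) by blast
  then show ?thesis
    unfolding scf_number_def by (rule LeastI_ex)
qed

end

theory Submission
  imports Defs
begin

text \<open>
  Repeatedly pick a class \<open>V\<close> of the remaining rectangles such that every edge \<open>e\<close> keeps at least
  \<open>min k |e| - 1\<close> of its members, give \<open>V\<close> a new colour and remove it. If \<open>V\<close> can always be chosen to
  contain a fraction \<open>1 / L\<close> of the remaining rectangles, then about \<open>L ln n\<close> colours suffice, and
  \<open>L = O(k log n)\<close> is possible: some level of an interval tree on the \<open>x\<close>-projections holds a fraction
  \<open>1 / log n\<close> of the rectangles, and those stored at one node all meet a common vertical line.
  To the right of that line, the edge at \<open>(x, y)\<close> consists of the rectangles over \<open>y\<close> reaching
  furthest to the right, so it suffices that, for every \<open>y\<close>, at most one of the \<open>k\<close> furthest reaching ones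
  lies in \<open>V\<close>; similarly to the left. A sweep over \<open>y\<close> shows that this forbids only \<open>O(k m)\<close> pairs
  among any \<open>m\<close> rectangles, so a greedy independent set contains a fraction \<open>1 / O(k)\<close> of them.
\<close>

section \<open>The top elements of a finite set\<close>

definition top_elems :: "nat \<Rightarrow> ('i \<Rightarrow> nat) \<Rightarrow> 'i set \<Rightarrow> 'i set" where
  "top_elems k f A = {x \<in> A. card {z \<in> A. f x < f z} < k}"

lemma top_elems_subset: "top_elems k f A \<subseteq> A"
  by (auto simp: top_elems_def)

lemma finite_top_elems: "finite A \<Longrightarrow> finite (top_elems k f A)"
  using finite_subset top_elems_subset by metis

lemma top_elems_upward:
  assumes "finite A" "x \<in> top_elems k f A" "z \<in> A" "f x \<le> f z"
  shows "z \<in> top_elems k f A"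
proof -
  have "card {w \<in> A. f z < f w} \<le> card {w \<in> A. f x < f w}"
    using assms by (intro card_mono) auto
  then show ?thesis
    using assms by (auto simp: top_elems_def)
qed

lemma card_top_elems_le:
  assumes "finite A" "inj_on f A"
  shows "card (top_elems k f A) \<le> k"
proof (cases "top_elems k f A = {}")
  case False
  let ?T = "top_elems k f A"
  have fin: "finite ?T"
    using assms finite_top_elems by metis
  define x where "x = arg_min_on f ?T"
  have x: "x \<in> ?T"
    unfolding x_def by (rule arg_min_if_finite(1)[OF fin False])
  have min: "f x \<le> f z" if "z \<in> ?T" for z
    unfolding x_def by (rule arg_min_least[OF fin False that])
  have "?T \<subseteq> insert x {z \<in> A. f x < f z}"
  proof
    fix z assume z: "z \<in> ?T"
    then have "z \<in> A" "x \<in> A"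
      using x by (auto simp: top_elems_def)
    then show "z \<in> insert x {z \<in> A. f x < f z}"
      using min[OF z] assms(2) by (auto simp: inj_on_def le_less)
  qed
  then have "card ?T \<le> card (insert x {z \<in> A. f x < f z})"
    using assms by (intro card_mono) auto
  also have "\<dots> \<le> k"
    using x assms by (auto simp: top_elems_def card_insert_if)
  finally show ?thesis .
qed simp

lemma card_top_elems_ge:
  assumes "finite A" "x \<in> A" "x \<notin> top_elems k f A"
  shows "k \<le> card (top_elems k f A)"
proof -
  let ?N = "A - top_elems k f A"
  have ne: "?N \<noteq> {}" and fin: "finite ?N"
    using assms by auto
  have "Max (f ` ?N) \<in> f ` ?N"
    using ne fin by (intro Max_in) auto
  then obtain y where y: "y \<in> ?N" "f y = Max (f ` ?N)"
    by auto
  have max: "f z \<le> f y" if "z \<in> ?N" for z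
    using y fin that by simp
  have "k \<le> card {z \<in> A. f y < f z}"
    using y(1) by (auto simp: top_elems_def)
  also have "\<dots> \<le> card (top_elems k f A)"
  proof (rule card_mono)
    show "{z \<in> A. f y < f z} \<subseteq> top_elems k f A"
      using max by force
  qed (use assms finite_top_elems in metis)
  finally show ?thesis .
qed

lemma min_card_le_card_top_elems:
  assumes "finite A"
  shows "min k (card A) \<le> card (top_elems k f A)"
proof (cases "top_elems k f A = A")
  case False
  then obtain x where "x \<in> A" "x \<notin> top_elems k f A"
    using top_elems_subset[of k f A] by blast
  then show ?thesis
    by (intro min.coboundedI1 card_top_elems_ge[OF assms])
qed simp

lemma card_top_elems_Diff_le:
  assumes fA: "finite A" and fB: "finite B" and inj: "inj_on f (A \<union> B)"
  shows "card (top_elems k f B - top_elems k f A) \<le> card (B - A) + card (A - B)"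
proof -
  let ?TA = "top_elems k f A" and ?TB = "top_elems k f B"
  define X where "X = (?TB - ?TA) \<inter> A"
  have finTA: "finite ?TA" and finTB: "finite ?TB"
    using fA fB finite_top_elems by metis+
  have finX: "finite X"
    using finTB by (simp add: X_def)
  have X: "card X \<le> card (A - B)"
  proof (cases "X = {}")
    case False
    define x where "x = arg_min_on f X"
    have x: "x \<in> X"
      unfolding x_def by (rule arg_min_if_finite(1)[OF finX False])
    have xA: "x \<in> A" "x \<notin> ?TA" "x \<in> ?TB"
      using x by (auto simp: X_def)
    have "(?TA \<inter> B) \<union> X \<subseteq> ?TB"
    proof
      fix z assume z: "z \<in> (?TA \<inter> B) \<union> X"
      show "z \<in> ?TB"
      proof (cases "z \<in> X")
        case True
        then show ?thesis by (auto simp: X_def)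
      next
        case False
        then have z': "z \<in> ?TA" "z \<in> B" using z by auto
        have "f x \<le> f z"
        proof (rule ccontr)
          assume "\<not> f x \<le> f z"
          then show False
            using top_elems_upward[OF fA z'(1) xA(1)] xA(2) by simp
        qed
        then show ?thesis
          using top_elems_upward[OF fB xA(3) z'(2)] by simp
      qed
    qed
    then have "card ((?TA \<inter> B) \<union> X) \<le> card ?TB"
      using finTB by (intro card_mono)
    also have "\<dots> \<le> k"
      using inj by (intro card_top_elems_le[OF fB]) (auto intro: inj_on_subset)
    also have "k \<le> card ?TA"
      using card_top_elems_ge[OF fA xA(1,2)] .
    also have "card ?TA = card (?TA \<inter> B) + card (?TA - B)"
      using finTA by (metis card_Int_Diff)
    finally have "card (?TA \<inter> B) + card X \<le> card (?TA \<inter> B) + card (?TA - B)"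
      using finTA finX by (subst (asm) card_Un_disjoint) (auto simp: X_def)
    moreover have "card (?TA - B) \<le> card (A - B)"
      using fA top_elems_subset[of k f A] by (intro card_mono) auto
    ultimately show ?thesis by simp
  qed simp
  have "card (?TB - ?TA) \<le> card ((B - A) \<union> X)"
    using finX fB top_elems_subset[of k f B] by (intro card_mono) (auto simp: X_def)
  also have "\<dots> \<le> card (B - A) + card X"
    by (rule card_Un_le)
  finally show ?thesis using X by simp
qed

lemma min_card_le_card_top_elems_Int:
  assumes "finite A" "e \<subseteq> A" and up: "\<And>x z. x \<in> e \<Longrightarrow> z \<in> A \<Longrightarrow> f x < f z \<Longrightarrow> z \<in> e"
  shows "min k (card e) \<le> card (top_elems k f A \<inter> e)"
proof -
  have fe: "finite e"
    using assms finite_subset by blast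
  have "top_elems k f e \<subseteq> top_elems k f A \<inter> e"
  proof
    fix x assume x: "x \<in> top_elems k f e"
    then have "{z \<in> A. f x < f z} = {z \<in> e. f x < f z}"
      using assms by (auto simp: top_elems_def)
    then show "x \<in> top_elems k f A \<inter> e"
      using x assms(2) by (auto simp: top_elems_def)
  qed
  then have "card (top_elems k f e) \<le> card (top_elems k f A \<inter> e)"
    using fe by (intro card_mono) auto
  then show ?thesis
    using min_card_le_card_top_elems[OF fe, of k f] by simp
qed

lemma ex_inj_on_nat_refining:
  fixes b :: "'i \<Rightarrow> real"
  assumes "finite S"
  shows "\<exists>f :: 'i \<Rightarrow> nat. inj_on f S \<and> (\<forall>i\<in>S. \<forall>j\<in>S. b i < b j \<longrightarrow> f i < f j)"
  using assms
proof (induction S rule: finite_ranking_induct[where f = b])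
  case (insert x S)
  show ?case
  proof (cases "x \<in> S")
    case True
    then show ?thesis using insert.IH by (simp add: insert_absorb)
  next
    case False
    obtain f :: "'i \<Rightarrow> nat" where
      f: "inj_on f S" "\<And>i j. i \<in> S \<Longrightarrow> j \<in> S \<Longrightarrow> b i < b j \<Longrightarrow> f i < f j"
      using insert.IH by blast
    define m where "m = Suc (Max (f ` S))"
    have m: "f i < m" if "i \<in> S" for i
      using insert.hyps that by (simp add: m_def less_Suc_eq_le)
    have "m \<notin> f ` S"
      using m by blast
    then have "inj_on (f(x := m)) (insert x S)"
      using inj_on_fun_updI[OF f(1)] False by (auto simp: inj_on_insert)
    moreover have "(f(x := m)) i < (f(x := m)) j"
      if "i \<in> insert x S" "j \<in> insert x S" "b i < b j" for i j
      using that f(2)[of i j] m[of i] insert.hyps(2)[of j] False by auto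
    ultimately show ?thesis by blast
  qed
qed auto

section \<open>Conflicts among intervals\<close>

definition stabbed :: "'i set \<Rightarrow> ('i \<Rightarrow> real) \<Rightarrow> ('i \<Rightarrow> real) \<Rightarrow> real \<Rightarrow> 'i set" where
  "stabbed S lo hi y = {i \<in> S. lo i \<le> y \<and> y \<le> hi i}"

definition conflicts ::
    "nat \<Rightarrow> ('i \<Rightarrow> nat) \<Rightarrow> 'i set \<Rightarrow> ('i \<Rightarrow> real) \<Rightarrow> ('i \<Rightarrow> real) \<Rightarrow> real set \<Rightarrow> ('i \<times> 'i) set" where
  "conflicts k f S lo hi Y =
     (\<Union>y\<in>Y. top_elems k f (stabbed S lo hi y) \<times> top_elems k f (stabbed S lo hi y))"

lemma stabbed_subset: "stabbed S lo hi y \<subseteq> S"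
  by (auto simp: stabbed_def)

lemma finite_stabbed: "finite S \<Longrightarrow> finite (stabbed S lo hi y)"
  by (auto simp: stabbed_def)

lemma conflicts_subset: "conflicts k f S lo hi Y \<subseteq> S \<times> S"
  by (auto simp: conflicts_def top_elems_def stabbed_def)

lemma conflicts_mono_set:
  assumes "finite S" "T \<subseteq> S"
  shows "conflicts k f S lo hi Y \<inter> T \<times> T \<subseteq> conflicts k f T lo hi Y"
proof -
  have "top_elems k f (stabbed S lo hi y) \<inter> T \<subseteq> top_elems k f (stabbed T lo hi y)" for y
  proof
    fix x assume x: "x \<in> top_elems k f (stabbed S lo hi y) \<inter> T"
    have "card {z \<in> stabbed T lo hi y. f x < f z} \<le> card {z \<in> stabbed S lo hi y. f x < f z}"
      using assms by (intro card_mono) (auto simp: stabbed_def)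
    then show "x \<in> top_elems k f (stabbed T lo hi y)"
      using x by (auto simp: top_elems_def stabbed_def)
  qed
  then show ?thesis
    unfolding conflicts_def by fast
qed

text \<open>Sweeping upwards, the set of the top \<open>k\<close> stabbed intervals gains at most one element whenever
  an interval begins or ends, and each gained element accounts for at most \<open>2k\<close> new pairs.\<close>

lemma card_conflicts_sweep:
  fixes Y :: "real set"
  assumes S: "finite S" and inj: "inj_on f S" and Y: "finite Y" "Y \<noteq> {}"
  shows "card (conflicts k f S lo hi Y) \<le>
    2 * k * (card (\<Union>y\<in>Y. stabbed S lo hi y) + card ((\<Union>y\<in>Y. stabbed S lo hi y) - stabbed S lo hi (Max Y)))"
  using Y
proof (induction Y rule: finite_linorder_max_induct)
  case empty
  then show ?case by simp
next
  case (insert y Y)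
  let ?s = "stabbed S lo hi"
  let ?T = "\<lambda>y. top_elems k f (?s y)"
  have fs: "finite (?s y)" for y using S by (rule finite_stabbed)
  have fT: "finite (?T y)" for y using fs by (rule finite_top_elems)
  have cT: "card (?T y) \<le> k" for y
    by (intro card_top_elems_le fs inj_on_subset[OF inj stabbed_subset])
  have U: "finite (\<Union>y\<in>Z. ?s y)" for Z
    by (rule finite_subset[OF _ S]) (auto simp: stabbed_def)
  have Max: "Max (insert y Y) = y"
    using insert.hyps by (intro Max_eqI) auto
  show ?case
  proof (cases "Y = {}")
    case True
    have "card (?T y \<times> ?T y) = card (?T y) * card (?T y)"
      by (rule card_cartesian_product)
    also have "\<dots> \<le> k * card (?s y)"
      using cT card_mono[OF fs top_elems_subset] by (intro mult_mono) auto
    finally show ?thesis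
      using True by (simp add: conflicts_def)
  next
    case False
    define m where "m = Max Y"
    have m: "m \<in> Y" "\<And>z. z \<in> Y \<Longrightarrow> z \<le> m" "m < y"
      using insert.hyps False by (auto simp: m_def)
    let ?U = "\<Union>y\<in>Y. ?s y"
    let ?N = "?T y - ?T m"
    have N: "card ?N \<le> card (?s y - ?s m) + card (?s m - ?s y)"
      by (intro card_top_elems_Diff_le fs inj_on_subset[OF inj] Un_least stabbed_subset)
    have "conflicts k f S lo hi (insert y Y) \<subseteq>
        conflicts k f S lo hi Y \<union> (?N \<times> ?T y \<union> ?T y \<times> ?N)"
      using m(1) unfolding conflicts_def by auto
    then have "card (conflicts k f S lo hi (insert y Y)) \<le>
        card (conflicts k f S lo hi Y \<union> (?N \<times> ?T y \<union> ?T y \<times> ?N))"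
      using insert.hyps fT by (intro card_mono) (auto simp: conflicts_def)
    also have "\<dots> \<le> card (conflicts k f S lo hi Y) + (card (?N \<times> ?T y) + card (?T y \<times> ?N))"
      by (meson add_left_mono card_Un_le order_trans)
    also have "\<dots> = card (conflicts k f S lo hi Y) + 2 * card (?T y) * card ?N"
      by (simp add: card_cartesian_product)
    also have "\<dots> \<le> card (conflicts k f S lo hi Y) + 2 * k * (card (?s y - ?s m) + card (?s m - ?s y))"
      using cT[of y] N by (intro add_left_mono mult_mono) auto
    also have "\<dots> \<le> 2 * k * (card ?U + card (?U - ?s m)) + 2 * k * (card (?s y - ?s m) + card (?s m - ?s y))"
      using insert.IH[OF False] by (simp add: m_def)
    also have "\<dots> = 2 * k * ((card ?U + card (?s y - ?s m)) + (card (?U - ?s m) + card (?s m - ?s y)))"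
      by (simp add: algebra_simps)
    also have "card ?U + card (?s y - ?s m) = card (?U \<union> (?s y - ?s m))"
    proof (rule card_Un_disjoint[symmetric])
      show "?U \<inter> (?s y - ?s m) = {}"
        using m by (fastforce simp: stabbed_def)
    qed (use fs U in auto)
    also have "?U \<union> (?s y - ?s m) = (\<Union>y\<in>insert y Y. ?s y)"
      using m(1) by auto
    also have "card (?U - ?s m) + card (?s m - ?s y) = card ((?U - ?s m) \<union> (?s m - ?s y))"
      by (rule card_Un_disjoint[symmetric]) (use fs U in auto)
    also have "(?U - ?s m) \<union> (?s m - ?s y) = (\<Union>y\<in>insert y Y. ?s y) - ?s y"
      using m by (fastforce simp: stabbed_def)
    finally show ?thesis
      by (simp only: Max)
  qed
qed

lemma card_conflicts_le:
  assumes S: "finite S" and inj: "inj_on f S"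
  shows "card (conflicts k f S lo hi UNIV) \<le> 4 * k * card S"
proof -
  let ?s = "stabbed S lo hi"
  have "range ?s \<subseteq> Pow S"
    by (auto simp: stabbed_def)
  then have "finite (range ?s)"
    using S by (meson finite_Pow_iff finite_subset)
  then obtain Y where Y: "finite Y" "range ?s = ?s ` Y"
    by (meson finite_subset_image subset_refl)
  then have ne: "Y \<noteq> {}" by auto
  have eq: "conflicts k f S lo hi Z = (\<Union>A\<in>?s ` Z. top_elems k f A \<times> top_elems k f A)" for Z
    by (simp add: conflicts_def)
  have "conflicts k f S lo hi UNIV = conflicts k f S lo hi Y"
    unfolding eq Y(2) ..
  also have "card \<dots> \<le> 2 * k * (card (\<Union>y\<in>Y. ?s y) + card ((\<Union>y\<in>Y. ?s y) - ?s (Max Y)))"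
    by (rule card_conflicts_sweep[OF S inj Y(1) ne])
  also have "\<dots> \<le> 2 * k * (card S + card S)"
  proof (intro mult_left_mono add_mono card_mono S)
    show "(\<Union>y\<in>Y. ?s y) \<subseteq> S" "(\<Union>y\<in>Y. ?s y) - ?s (Max Y) \<subseteq> S"
      by (auto simp: stabbed_def)
  qed auto
  finally show ?thesis by (simp add: algebra_simps)
qed

section \<open>Large sets without conflicts\<close>

lemma ex_large_independent_set:
  fixes E :: "('i \<times> 'i) set"
  assumes "finite S" and "sym E"
    and "\<And>T. T \<subseteq> S \<Longrightarrow> T \<noteq> {} \<Longrightarrow> \<exists>v\<in>T. card {j \<in> T. (v, j) \<in> E} \<le> D"
  shows "\<exists>V\<subseteq>S. card S \<le> (D + 1) * card V \<and> (\<forall>i\<in>V. \<forall>j\<in>V. (i, j) \<in> E \<longrightarrow> i = j)"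
  using assms(1,3)
proof (induction S rule: finite_psubset_induct)
  case (psubset S)
  show ?case
  proof (cases "S = {}")
    case False
    then obtain v where v: "v \<in> S" "card {j \<in> S. (v, j) \<in> E} \<le> D"
      using psubset.prems by blast
    let ?N = "insert v {j \<in> S. (v, j) \<in> E}"
    have less: "S - ?N \<subset> S" using v(1) by blast
    have "\<exists>v\<in>T. card {j \<in> T. (v, j) \<in> E} \<le> D" if "T \<subseteq> S - ?N" "T \<noteq> {}" for T
      by (rule psubset.prems) (use that in auto)
    from psubset.IH[OF less this]
    obtain V where V: "V \<subseteq> S - ?N" "card (S - ?N) \<le> (D + 1) * card V"
        "\<forall>i\<in>V. \<forall>j\<in>V. (i, j) \<in> E \<longrightarrow> i = j"
      by blast
    have finV: "finite V"
      using V(1) psubset.hyps by (meson finite_Diff finite_subset)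
    have "card S \<le> card (S - ?N) + card ?N"
    proof -
      have "S = (S - ?N) \<union> ?N" using v(1) by blast
      then show ?thesis by (metis card_Un_le)
    qed
    also have "card ?N \<le> D + 1"
      using v(2) psubset.hyps by (simp add: card_insert_if)
    finally have "card S \<le> (D + 1) * (card V + 1)"
      using V(2) by (simp add: algebra_simps)
    moreover have "card (insert v V) = card V + 1"
      using V(1) finV by (subst card_insert_disjoint) auto
    moreover have "insert v V \<subseteq> S"
      using V(1) v(1) by auto
    moreover have "\<forall>i\<in>insert v V. \<forall>j\<in>insert v V. (i, j) \<in> E \<longrightarrow> i = j"
      using V assms(2) by (auto dest: symD)
    ultimately show ?thesis by metis
  qed simp
qed

definition rects_at ::
    "'i set \<Rightarrow> ('i \<Rightarrow> real) \<Rightarrow> ('i \<Rightarrow> real) \<Rightarrow> ('i \<Rightarrow> real) \<Rightarrow> ('i \<Rightarrow> real) \<Rightarrow> real \<Rightarrow> real \<Rightarrow> 'i set" where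
  "rects_at S a b lo hi x y = {i \<in> S. a i \<le> x \<and> x \<le> b i \<and> lo i \<le> y \<and> y \<le> hi i}"

lemma ex_large_class_common_line:
  assumes S: "finite S" and q: "\<And>i. i \<in> S \<Longrightarrow> a i \<le> q \<and> q \<le> b i"
  shows "\<exists>V\<subseteq>S. card S \<le> (8 * k + 1) * card V \<and>
    (\<forall>x y. min k (card (rects_at S a b lo hi x y)) \<le> card (rects_at S a b lo hi x y - V) + 1)"
proof -
  obtain f :: "'a \<Rightarrow> nat" where
    f: "inj_on f S" "\<And>i j. i \<in> S \<Longrightarrow> j \<in> S \<Longrightarrow> b i < b j \<Longrightarrow> f i < f j"
    using ex_inj_on_nat_refining[OF S, of b] by blast
  obtain g :: "'a \<Rightarrow> nat" where
    g: "inj_on g S" "\<And>i j. i \<in> S \<Longrightarrow> j \<in> S \<Longrightarrow> - a i < - a j \<Longrightarrow> g i < g j"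
    using ex_inj_on_nat_refining[OF S, of "\<lambda>i. - a i"] by blast
  define E where "E = conflicts k f S lo hi UNIV \<union> conflicts k g S lo hi UNIV"
  have deg: "\<exists>v\<in>T. card {j \<in> T. (v, j) \<in> E} \<le> 8 * k" if T: "T \<subseteq> S" "T \<noteq> {}" for T
  proof (rule ccontr)
    assume "\<not> ?thesis"
    then have big: "8 * k + 1 \<le> card {j \<in> T. (v, j) \<in> E}" if "v \<in> T" for v
      using that by force
    have fT: "finite T" using T S finite_subset by blast
    have inj: "inj_on f T" "inj_on g T" using f g T inj_on_subset by blast+
    have fin: "finite (conflicts k h T lo hi UNIV)" for h
      using conflicts_subset fT by (metis finite_SigmaI finite_subset)
    have "(8 * k + 1) * card T = (\<Sum>v\<in>T. 8 * k + 1)" by simp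
    also have "\<dots> \<le> (\<Sum>v\<in>T. card {j \<in> T. (v, j) \<in> E})"
      using big by (intro sum_mono)
    also have "\<dots> = card (SIGMA v:T. {j \<in> T. (v, j) \<in> E})"
      using fT by (simp add: card_SigmaI)
    also have "\<dots> \<le> card (conflicts k f T lo hi UNIV \<union> conflicts k g T lo hi UNIV)"
    proof (rule card_mono)
      show "(SIGMA v:T. {j \<in> T. (v, j) \<in> E}) \<subseteq> conflicts k f T lo hi UNIV \<union> conflicts k g T lo hi UNIV"
        using conflicts_mono_set[OF S T(1), of k f lo hi UNIV]
          conflicts_mono_set[OF S T(1), of k g lo hi UNIV] by (auto simp: E_def)
    qed (use fin in auto)
    also have "\<dots> \<le> 4 * k * card T + 4 * k * card T"
      using card_Un_le card_conflicts_le[OF fT inj(1)] card_conflicts_le[OF fT inj(2)]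
      by (meson add_mono order_trans)
    finally have "card T = 0" by simp
    then show False using T fT by simp
  qed
  have "sym E"
    by (auto simp: E_def sym_def conflicts_def)
  from ex_large_independent_set[OF S this deg] obtain V where V: "V \<subseteq> S" "card S \<le> (8 * k + 1) * card V"
      "\<forall>i\<in>V. \<forall>j\<in>V. (i, j) \<in> E \<longrightarrow> i = j"
    by blast
  have "min k (card (rects_at S a b lo hi x y)) \<le> card (rects_at S a b lo hi x y - V) + 1" for x y
  proof -
    let ?e = "rects_at S a b lo hi x y" and ?A = "stabbed S lo hi y"
    have fA: "finite ?A" using S by (rule finite_stabbed)
    have sub: "?e \<subseteq> ?A" by (auto simp: rects_at_def stabbed_def)
    have fe: "finite ?e" using sub fA finite_subset by blast
    obtain h :: "'a \<Rightarrow> nat" where h: "conflicts k h S lo hi UNIV \<subseteq> E"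
      "\<And>i j. i \<in> ?e \<Longrightarrow> j \<in> ?A \<Longrightarrow> h i < h j \<Longrightarrow> j \<in> ?e"
    proof (cases "x \<le> q")
      case False
      have "j \<in> ?e" if "i \<in> ?e" "j \<in> ?A" "f i < f j" for i j
        using that f(2)[of j i] q[of j] False by (force simp: rects_at_def stabbed_def)
      then show ?thesis by (intro that[of f]) (auto simp: E_def)
    next
      case True
      have "j \<in> ?e" if "i \<in> ?e" "j \<in> ?A" "g i < g j" for i j
        using that g(2)[of j i] q[of j] True by (force simp: rects_at_def stabbed_def)
      then show ?thesis by (intro that[of g]) (auto simp: E_def)
    qed
    let ?T = "top_elems k h ?A \<inter> ?e"
    have fT: "finite ?T" using fe by simp
    have "i = j" if "i \<in> ?T \<inter> V" "j \<in> ?T \<inter> V" for i j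
    proof -
      have "(i, j) \<in> conflicts k h S lo hi UNIV"
        using that by (auto simp: conflicts_def)
      then show ?thesis using that V(3) h(1) by blast
    qed
    then have "card (?T \<inter> V) \<le> Suc 0"
      using fT by (subst card_le_Suc0_iff_eq) auto
    moreover have "card ?T = card (?T \<inter> V) + card (?T - V)"
      using fT by (metis card_Int_Diff)
    moreover have "card (?T - V) \<le> card (?e - V)"
      using fe by (intro card_mono) auto
    moreover have "min k (card ?e) \<le> card ?T"
      by (rule min_card_le_card_top_elems_Int[OF fA sub]) (rule h(2))
    ultimately show ?thesis by linarith
  qed
  then show ?thesis using V by blast
qed

section \<open>Divide and conquer\<close>

lemma ex_balanced_cut:
  fixes a :: "'i \<Rightarrow> real"
  assumes "finite S" "S \<noteq> {}" "card S < 2 * m" "m > 0"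
  shows "\<exists>q. card {i \<in> S. a i < q} < m \<and> card {i \<in> S. q < a i} < m"
proof -
  let ?Q = "{r \<in> a ` S. card {i \<in> S. r < a i} < m}"
  have "a i \<le> Max (a ` S)" if "i \<in> S" for i
    using that assms by simp
  then have "{i \<in> S. Max (a ` S) < a i} = {}"
    using leD by blast
  then have "card {i \<in> S. Max (a ` S) < a i} < m"
    using assms by (simp only: card.empty)
  then have "Max (a ` S) \<in> ?Q"
    using assms Max_in[of "a ` S"] by blast
  then have ne: "?Q \<noteq> {}" by blast
  have fin: "finite ?Q" using assms by simp
  define q where "q = Min ?Q"
  have q: "q \<in> ?Q" unfolding q_def by (rule Min_in[OF fin ne])
  have "card {i \<in> S. a i < q} < m"
  proof (cases "{i \<in> S. a i < q} = {}")
    case False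
    let ?B = "a ` {i \<in> S. a i < q}"
    define r where "r = Max ?B"
    have "r \<in> ?B" unfolding r_def using False assms by (intro Max_in) auto
    then have r: "r \<in> a ` S" "r < q" by auto
    have "r \<notin> ?Q"
      using r(2) Min_le[OF fin, of r] unfolding q_def by (meson not_le)
    then have big: "m \<le> card {i \<in> S. r < a i}"
      using r by auto
    have "{i \<in> S. a i < q} \<inter> {i \<in> S. r < a i} = {}"
    proof -
      have "a i \<le> r" if "i \<in> S" "a i < q" for i
        unfolding r_def using that assms by (intro Max_ge) auto
      then show ?thesis by force
    qed
    then have "card {i \<in> S. a i < q} + card {i \<in> S. r < a i} = card ({i \<in> S. a i < q} \<union> {i \<in> S. r < a i})"
      using assms by (subst card_Un_disjoint) auto
    also have "\<dots> \<le> card S"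
      using assms by (intro card_mono) auto
    finally show ?thesis using big assms by simp
  next
    case True
    then show ?thesis using assms by (simp only: card.empty)
  qed
  then show ?thesis using q by auto
qed

text \<open>\<open>q i\<close> is the cutting line of the node of the recursion tree at which interval \<open>i\<close> is stored,
  and \<open>l i\<close> is the depth of this node.\<close>

lemma ex_interval_tree:
  fixes a b :: "'i \<Rightarrow> real"
  assumes "finite S" "card S < 2 ^ d" "\<And>i. i \<in> S \<Longrightarrow> a i \<le> b i"
  shows "\<exists>(l :: 'i \<Rightarrow> nat) (q :: 'i \<Rightarrow> real). \<forall>i\<in>S. l i < d \<and> a i \<le> q i \<and> q i \<le> b i \<and>
    (\<forall>j\<in>S. \<forall>x. l i = l j \<longrightarrow> a i \<le> x \<longrightarrow> x \<le> b i \<longrightarrow> a j \<le> x \<longrightarrow> x \<le> b j \<longrightarrow> q i = q j)"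
  using assms
proof (induction d arbitrary: S)
  case 0
  then show ?case by simp
next
  case (Suc d)
  show ?case
  proof (cases "S = {}")
    case False
    obtain r where r: "card {i \<in> S. a i < r} < 2 ^ d" "card {i \<in> S. r < a i} < 2 ^ d"
      using ex_balanced_cut[of S "2 ^ d" a] Suc.prems False by auto
    define L where "L = {i \<in> S. b i < r}"
    define R where "R = {i \<in> S. r < a i}"
    have "card L \<le> card {i \<in> S. a i < r}"
      using Suc.prems by (intro card_mono) (force simp: L_def)+
    then obtain l1 q1 where IL: "\<forall>i\<in>L. l1 i < d \<and> a i \<le> q1 i \<and> q1 i \<le> b i \<and>
      (\<forall>j\<in>L. \<forall>x. l1 i = l1 j \<longrightarrow> a i \<le> x \<longrightarrow> x \<le> b i \<longrightarrow> a j \<le> x \<longrightarrow> x \<le> b j \<longrightarrow> q1 i = q1 j)"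
      using Suc.IH[of L] Suc.prems r(1) by (auto simp: L_def)
    obtain l2 q2 where IR: "\<forall>i\<in>R. l2 i < d \<and> a i \<le> q2 i \<and> q2 i \<le> b i \<and>
      (\<forall>j\<in>R. \<forall>x. l2 i = l2 j \<longrightarrow> a i \<le> x \<longrightarrow> x \<le> b i \<longrightarrow> a j \<le> x \<longrightarrow> x \<le> b j \<longrightarrow> q2 i = q2 j)"
      using Suc.IH[of R] Suc.prems r(2) by (auto simp: R_def)
    define l where "l i = (if b i < r then l1 i else if r < a i then l2 i else d)" for i
    define q where "q i = (if b i < r then q1 i else if r < a i then q2 i else r)" for i
    have ab: "a i \<le> b i" if "i \<in> S" for i using Suc.prems that by simp
    have L: "l i = l1 i \<and> q i = q1 i" if "i \<in> L" for i
      using that by (auto simp: L_def l_def q_def)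
    have R: "l i = l2 i \<and> q i = q2 i" if "i \<in> R" for i
      using that ab[of i] by (auto simp: R_def l_def q_def)
    have M: "l i = d \<and> q i = r \<and> a i \<le> r \<and> r \<le> b i" if "i \<in> S - L - R" for i
      using that by (auto simp: L_def R_def l_def q_def)
    have "l i < Suc d \<and> a i \<le> q i \<and> q i \<le> b i" if i: "i \<in> S" for i
    proof -
      consider "i \<in> L" | "i \<in> R" | "i \<in> S - L - R" using i by blast
      then show ?thesis
        by cases (use IL IR L R M in \<open>auto simp: less_Suc_eq\<close>)
    qed
    moreover have "q i = q j" if ij: "i \<in> S" "j \<in> S" "l i = l j" "a i \<le> x" "x \<le> b i" "a j \<le> x" "x \<le> b j"
      for i j x
    proof -
      consider "i \<in> L" "j \<in> L" | "i \<in> R" "j \<in> R" | "i \<in> S - L - R" "j \<in> S - L - R"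
        | "i \<in> L \<union> R" "j \<in> S - L - R" | "i \<in> S - L - R" "j \<in> L \<union> R"
        | "i \<in> L" "j \<in> R" | "i \<in> R" "j \<in> L"
        using ij by blast
      then show ?thesis
      proof cases
        case 1
        then show ?thesis using IL L ij by metis
      next
        case 2
        then show ?thesis using IR R ij by metis
      next
        case 3
        then show ?thesis using M by simp
      next
        case 4
        then have "l i < d" "l j = d" using IL IR L R M by auto
        then show ?thesis using ij by simp
      next
        case 5
        then have "l j < d" "l i = d" using IL IR L R M by auto
        then show ?thesis using ij by simp
      next
        case 6
        then show ?thesis using ij by (simp add: L_def R_def)
      next
        case 7
        then show ?thesis using ij by (simp add: L_def R_def)
      qed
    qed
    ultimately show ?thesis by blast
  qed simp
qed

lemma ex_large_class:
  fixes a b lo hi :: "'i \<Rightarrow> real"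
  assumes S: "finite S" "card S < 2 ^ d" and ab: "\<And>i. i \<in> S \<Longrightarrow> a i \<le> b i"
  shows "\<exists>V\<subseteq>S. card S \<le> (8 * k + 1) * d * card V \<and>
    (\<forall>x y. min k (card (rects_at S a b lo hi x y)) \<le> card (rects_at S a b lo hi x y - V) + 1)"
proof -
  obtain l :: "'i \<Rightarrow> nat" and q :: "'i \<Rightarrow> real" where
    l: "\<And>i. i \<in> S \<Longrightarrow> l i < d" and
    q: "\<And>i. i \<in> S \<Longrightarrow> a i \<le> q i \<and> q i \<le> b i" and
    eq: "\<And>i j x. i \<in> S \<Longrightarrow> j \<in> S \<Longrightarrow> l i = l j \<Longrightarrow> a i \<le> x \<Longrightarrow> x \<le> b i \<Longrightarrow> a j \<le> x \<Longrightarrow> x \<le> b j \<Longrightarrow> q i = q j"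
    using ex_interval_tree[of S d a b, OF S ab] by blast
  define level where "level t = {i \<in> S. l i = t}" for t
  have flevel: "finite (level t)" for t using S by (simp add: level_def)
  have "\<exists>t. card S \<le> d * card (level t)"
  proof (rule ccontr)
    assume "\<not> ?thesis"
    then have small: "d * card (level t) < card S" for t by (simp add: not_le)
    have "S = (\<Union>t<d. level t)" using l by (auto simp: level_def)
    then have "card S \<le> (\<Sum>t<d. card (level t))"
      by (metis card_UN_le finite_lessThan)
    then have "d * card S \<le> (\<Sum>t<d. d * card (level t))"
      by (simp add: sum_distrib_left[symmetric])
    also have "\<dots> < (\<Sum>t<d. card S)"
    proof (rule sum_strict_mono)
      have "S \<noteq> {}" using small[of 0] by auto
      then show "{..<d} \<noteq> {}" using l by fastforce
    qed (use small in auto)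
    finally show False by simp
  qed
  then obtain t where t: "card S \<le> d * card (level t)" by blast
  define node where "node r = {i \<in> level t. q i = r}" for r
  have fnode: "finite (node r)" for r using flevel by (simp add: node_def)
  have "\<exists>V\<subseteq>node r. card (node r) \<le> (8 * k + 1) * card V \<and>
    (\<forall>x y. min k (card (rects_at (node r) a b lo hi x y)) \<le> card (rects_at (node r) a b lo hi x y - V) + 1)" for r
    using q by (intro ex_large_class_common_line[where q = r] fnode) (auto simp: node_def level_def)
  then obtain W where W: "\<And>r. W r \<subseteq> node r" "\<And>r. card (node r) \<le> (8 * k + 1) * card (W r)"
    "\<And>r x y. min k (card (rects_at (node r) a b lo hi x y)) \<le> card (rects_at (node r) a b lo hi x y - W r) + 1"
    by metis
  define V where "V = (\<Union>r\<in>q ` level t. W r)"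
  have fW: "finite (W r)" for r using W(1) fnode finite_subset by blast
  have Vlevel: "V \<subseteq> level t" using W(1) by (auto simp: V_def node_def)
  have "level t = (\<Union>r\<in>q ` level t. node r)" by (auto simp: node_def)
  then have "card (level t) \<le> (\<Sum>r\<in>q ` level t. card (node r))"
    using flevel by (metis card_UN_le finite_imageI)
  also have "\<dots> \<le> (\<Sum>r\<in>q ` level t. (8 * k + 1) * card (W r))"
    by (intro sum_mono W)
  also have "\<dots> = (8 * k + 1) * (\<Sum>r\<in>q ` level t. card (W r))"
    by (simp only: sum_distrib_left)
  also have "(\<Sum>r\<in>q ` level t. card (W r)) = card V"
    unfolding V_def
  proof (rule card_UN_disjoint[symmetric])
    show "\<forall>r\<in>q ` level t. \<forall>s\<in>q ` level t. r \<noteq> s \<longrightarrow> W r \<inter> W s = {}"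
    proof (intro ballI impI)
      fix r s :: real assume "r \<noteq> s"
      then have "node r \<inter> node s = {}" by (auto simp: node_def)
      then show "W r \<inter> W s = {}" using W(1)[of r] W(1)[of s] by blast
    qed
  qed (use fW flevel in auto)
  finally have "d * card (level t) \<le> d * ((8 * k + 1) * card V)"
    by (rule mult_left_mono) simp
  then have "card S \<le> (8 * k + 1) * d * card V"
    using t by (metis mult.assoc mult.commute order_trans)
  moreover have "min k (card (rects_at S a b lo hi x y)) \<le> card (rects_at S a b lo hi x y - V) + 1" for x y
  proof -
    let ?e = "rects_at S a b lo hi x y"
    have fe: "finite ?e" using S by (simp add: rects_at_def)
    show ?thesis
    proof (cases "?e \<inter> level t = {}")
      case True
      then have "?e - V = ?e" using Vlevel by blast
      then show ?thesis by simp
    next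
      case False
      then obtain i where i: "i \<in> ?e" "i \<in> level t" by blast
      define r where "r = q i"
      let ?f = "rects_at (node r) a b lo hi x y"
      have f: "?f = ?e \<inter> level t"
      proof -
        have "q j = r" if "j \<in> ?e \<inter> level t" for j
          unfolding r_def by (rule eq[of _ _ x]) (use i that in \<open>auto simp: rects_at_def level_def\<close>)
        then show ?thesis by (auto simp: rects_at_def node_def level_def)
      qed
      have "?f \<inter> V \<subseteq> W r"
      proof
        fix j assume j: "j \<in> ?f \<inter> V"
        then obtain s where s: "j \<in> W s" by (auto simp: V_def)
        then have "q j = s" using W(1)[of s] by (auto simp: node_def)
        moreover have "q j = r" using j by (simp add: rects_at_def node_def)
        ultimately show "j \<in> W r" using s by simp
      qed
      moreover have "W r \<subseteq> V" using i by (auto simp: V_def r_def)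
      ultimately have "?f - W r = ?f - V" by blast
      then have "min k (card ?f) \<le> card (?f - V) + 1"
        using W(3)[of r x y] by simp
      moreover have "card ?e = card ?f + card (?e - level t)"
        unfolding f by (rule card_Int_Diff[OF fe])
      moreover have "card (?e - V) = card (?f - V) + card (?e - level t)"
      proof -
        have "?e - V = (?f - V) \<union> (?e - level t)" unfolding f using Vlevel by auto
        moreover have "card ((?f - V) \<union> (?e - level t)) = card (?f - V) + card (?e - level t)"
          unfolding f using fe by (intro card_Un_disjoint) auto
        ultimately show ?thesis by (simp only:)
      qed
      ultimately show ?thesis by linarith
    qed
  qed
  moreover have "V \<subseteq> S" using Vlevel by (auto simp: level_def)
  ultimately show ?thesis by blast
qed

section \<open>Iterating the removal of a class\<close>

text \<open>Each removal leaves at least \<open>k - 1\<close> elements in an edge with more than \<open>k\<close> elements, and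
  takes at most one element from an edge with at most \<open>k\<close> elements.\<close>

lemma ex_scf_coloring_of_classes:
  fixes F :: "'i set set" and L :: real
  assumes R: "finite R" and L: "L > 0"
    and cls: "\<And>S. S \<subseteq> R \<Longrightarrow> S \<noteq> {} \<Longrightarrow> \<exists>V\<subseteq>S. real (card S) \<le> L * real (card V) \<and>
      (\<forall>e\<in>F. min k (card (e \<inter> S)) \<le> card (e \<inter> S - V) + 1)"
  shows "\<exists>c :: 'i \<Rightarrow> nat. (R \<noteq> {} \<longrightarrow> real (card (c ` R)) \<le> 1 + L * ln (real (card R))) \<and>
    (\<forall>e\<in>F. (card (e \<inter> R) \<le> k \<longrightarrow> inj_on c (e \<inter> R)) \<and>
      (k \<le> card (e \<inter> R) \<longrightarrow> k \<le> card (uniquely_coloured c (e \<inter> R)) + 1))"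
  using R cls
proof (induction R rule: finite_psubset_induct)
  case (psubset S)
  show ?case
  proof (cases "S = {}")
    case True
    then show ?thesis by simp
  next
    case False
    then obtain V where V: "V \<subseteq> S" "real (card S) \<le> L * real (card V)"
      "\<And>e. e \<in> F \<Longrightarrow> min k (card (e \<inter> S)) \<le> card (e \<inter> S - V) + 1"
      using psubset.prems[of S] by blast
    have fV: "finite V" using V(1) psubset.hyps finite_subset by blast
    have "card S > 0" using False psubset.hyps by (simp add: card_gt_0_iff)
    then have "V \<noteq> {}" using V(2) by auto
    then have less: "S - V \<subset> S" using V(1) by blast
    let ?S = "S - V"
    have "\<exists>V\<subseteq>T. real (card T) \<le> L * real (card V) \<and>
        (\<forall>e\<in>F. min k (card (e \<inter> T)) \<le> card (e \<inter> T - V) + 1)" if "T \<subseteq> ?S" "T \<noteq> {}" for T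
      by (rule psubset.prems) (use that in auto)
    from psubset.IH[OF less this] obtain c :: "'i \<Rightarrow> nat" where
      c: "?S \<noteq> {} \<Longrightarrow> real (card (c ` ?S)) \<le> 1 + L * ln (real (card ?S))"
        "\<And>e. e \<in> F \<Longrightarrow> card (e \<inter> ?S) \<le> k \<Longrightarrow> inj_on c (e \<inter> ?S)"
        "\<And>e. e \<in> F \<Longrightarrow> k \<le> card (e \<inter> ?S) \<Longrightarrow> k \<le> card (uniquely_coloured c (e \<inter> ?S)) + 1"
      by blast
    define m where "m = Suc (Max (c ` ?S))"
    have m: "c i < m" if "i \<in> ?S" for i
      using psubset.hyps that by (simp add: m_def less_Suc_eq_le)
    define c' where "c' i = (if i \<in> V then m else c i)" for i
    have c'S: "c' i = c i" if "i \<in> ?S" for i using that by (simp add: c'_def)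
    have "card (c' ` S) \<le> card (insert m (c ` ?S))"
      using psubset.hyps by (intro card_mono) (auto simp: c'_def)
    also have "\<dots> \<le> card (c ` ?S) + 1"
      by (simp add: card_insert_le_m1 card_insert_if psubset.hyps)
    finally have cc: "real (card (c' ` S)) \<le> real (card (c ` ?S)) + 1" by linarith
    have "real (card (c' ` S)) \<le> 1 + L * ln (real (card S))"
    proof (cases "?S = {}")
      case True
      have "ln (real (card S)) \<ge> 0" using \<open>card S > 0\<close> by simp
      then have "0 \<le> L * ln (real (card S))" using L by simp
      moreover have "real (card (c' ` S)) \<le> 1"
        using cc unfolding True by simp
      ultimately show ?thesis by linarith
    next
      case S': False
      have pos: "real (card ?S) > 0" using S' psubset.hyps by (simp add: card_gt_0_iff)
      have "real (card ?S) = real (card S) - real (card V)"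
        using V(1) fV psubset.hyps by (simp add: card_Diff_subset card_mono)
      moreover have "real (card S) / L \<le> real (card V)"
        using V(2) L by (simp add: field_simps)
      ultimately have le: "real (card ?S) \<le> real (card S) * (1 - 1 / L)"
        by (simp add: algebra_simps)
      have "0 < 1 - 1 / L"
        using le pos \<open>card S > 0\<close> by (smt (verit) mult_nonneg_nonpos of_nat_0_le_iff)
      then have "ln (real (card S) * (1 - 1 / L)) = ln (real (card S)) + ln (1 - 1 / L)"
        using \<open>card S > 0\<close> by (intro ln_mult_pos) auto
      moreover have "ln (1 - 1 / L) \<le> - (1 / L)"
        using ln_le_minus_one[OF \<open>0 < 1 - 1 / L\<close>] by simp
      moreover have "ln (real (card ?S)) \<le> ln (real (card S) * (1 - 1 / L))"
        using le pos by (intro ln_mono) auto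
      ultimately have "ln (real (card ?S)) \<le> ln (real (card S)) - 1 / L" by linarith
      then have "L * ln (real (card ?S)) \<le> L * (ln (real (card S)) - 1 / L)"
        using L by (intro mult_left_mono) auto
      also have "\<dots> = L * ln (real (card S)) - 1" using L by (simp add: algebra_simps)
      finally show ?thesis using cc c(1)[OF S'] by linarith
    qed
    moreover have "(card (e \<inter> S) \<le> k \<longrightarrow> inj_on c' (e \<inter> S)) \<and>
      (k \<le> card (e \<inter> S) \<longrightarrow> k \<le> card (uniquely_coloured c' (e \<inter> S)) + 1)" if e: "e \<in> F" for e
    proof -
      let ?e = "e \<inter> S" and ?e' = "e \<inter> ?S"
      have eq: "?e - V = ?e'" by blast
      have fe: "finite ?e" using psubset.hyps by simp
      have split: "card ?e = card (?e \<inter> V) + card ?e'"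
        using fe eq by (metis card_Int_Diff)
      have V3: "min k (card ?e) \<le> card ?e' + 1" using V(3)[OF e] by (simp add: eq)
      have small: "inj_on c' ?e" if le: "card ?e \<le> k"
      proof -
        have "card (?e \<inter> V) \<le> Suc 0" using le V3 split by simp
        then have one: "i = j" if "i \<in> ?e \<inter> V" "j \<in> ?e \<inter> V" for i j
          using that fe card_le_Suc0_iff_eq[of "?e \<inter> V"] by blast
        have inj: "inj_on c ?e'" using c(2)[OF e] le split by simp
        show ?thesis
        proof (rule inj_onI)
          fix i j assume ij: "i \<in> ?e" "j \<in> ?e" "c' i = c' j"
          show "i = j"
          proof (cases "i \<in> V"; cases "j \<in> V")
            assume "i \<in> V" "j \<in> V" then show ?thesis using one ij by blast
          next
            assume "i \<in> V" "j \<notin> V" then show ?thesis using ij m[of j] by (simp add: c'_def)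
          next
            assume "i \<notin> V" "j \<in> V" then show ?thesis using ij m[of i] by (simp add: c'_def)
          next
            assume "i \<notin> V" "j \<notin> V" then show ?thesis
              using ij inj by (auto simp: c'_def inj_on_def)
          qed
        qed
      qed
      have sub: "uniquely_coloured c ?e' \<subseteq> uniquely_coloured c' ?e"
        unfolding uniquely_coloured_def using m by (force simp: c'_def)
      have "card (uniquely_coloured c ?e') \<le> card (uniquely_coloured c' ?e)"
        using sub fe by (intro card_mono) (auto simp: uniquely_coloured_def intro: finite_subset[OF _ fe])
      moreover have "k \<le> card (uniquely_coloured c ?e') + 1" if "k \<le> card ?e"
      proof (cases "k \<le> card ?e'")
        case True
        then show ?thesis using c(3)[OF e] by simp
      next
        case False
        then have "inj_on c ?e'" using c(2)[OF e] by simp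
        then have "uniquely_coloured c ?e' = ?e'"
          by (auto simp: uniquely_coloured_def inj_on_def)
        then show ?thesis using V3 that by simp
      qed
      ultimately show ?thesis using small by auto
    qed
    ultimately show ?thesis by blast
  qed
qed

theorem theorem5:
  "\<exists>C::real. \<forall>(k::nat) (n::nat) (R :: (real \<times> real) set set).
     k \<ge> 2 \<longrightarrow> n \<ge> 2 \<longrightarrow> finite R \<longrightarrow> card R = n \<longrightarrow>
     (\<forall>A\<in>R. axis_parallel_rectangle A) \<longrightarrow>
     real (scf_number (induced_hypergraph R) (k - 1)) \<le> C * real k * (log 2 (real n))\<^sup>2"
proof (intro exI[of _ "19 :: real"] allI impI)
  fix k n :: nat and R :: "(real \<times> real) set set"
  assume k: "k \<ge> 2" and n: "n \<ge> 2" and R: "finite R" "card R = n"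
    and rect: "\<forall>A\<in>R. axis_parallel_rectangle A"
  from rect obtain a b lo hi where
    coord: "\<And>A. A \<in> R \<Longrightarrow> a A < b A \<and> A = {a A..b A} \<times> {lo A..hi A}"
    unfolding axis_parallel_rectangle_def by metis
  define d where "d = nat \<lfloor>log 2 (real n)\<rfloor> + 1"
  have log1: "1 \<le> log 2 (real n)"
    using n by (simp add: le_log_iff)
  have "log 2 (real n) < real d"
    unfolding d_def using log1 by linarith
  then have "real n < 2 powr real d"
    using n by (simp add: log_less_iff)
  then have nd: "n < 2 ^ d"
    by (simp add: powr_realpow)
  have d: "real d \<le> 2 * log 2 (real n)"
    unfolding d_def using log1 by linarith
  define F where "F = range (regions_at R)"
  let ?L = "real ((8 * k + 1) * d)"
  have "?L > 0" unfolding of_nat_0_less_iff by (simp add: d_def)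
  moreover have "\<exists>V\<subseteq>S. real (card S) \<le> ?L * real (card V) \<and>
      (\<forall>e\<in>F. min k (card (e \<inter> S)) \<le> card (e \<inter> S - V) + 1)" if S: "S \<subseteq> R" for S
  proof -
    have "finite S" using S R finite_subset by blast
    moreover have "card S < 2 ^ d" using S R nd card_mono[of R S] by simp
    moreover have "a A \<le> b A" if "A \<in> S" for A using coord S that by (meson less_imp_le subsetD)
    ultimately obtain V where V: "V \<subseteq> S" "card S \<le> (8 * k + 1) * d * card V"
      "\<And>x y. min k (card (rects_at S a b lo hi x y)) \<le> card (rects_at S a b lo hi x y - V) + 1"
      using ex_large_class[of S d a b k lo hi] by blast
    have "regions_at R (x, y) \<inter> S = rects_at S a b lo hi x y" for x y
    proof -
      have "(x, y) \<in> A \<longleftrightarrow> a A \<le> x \<and> x \<le> b A \<and> lo A \<le> y \<and> y \<le> hi A" if "A \<in> R" for A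
        by (subst conjunct2[OF coord[OF that]]) auto
      then show ?thesis using S by (auto simp: regions_at_def rects_at_def)
    qed
    then have "\<forall>e\<in>F. min k (card (e \<inter> S)) \<le> card (e \<inter> S - V) + 1"
      using V(3) by (auto simp: F_def)
    moreover have "real (card S) \<le> ?L * real (card V)"
      using V(2) by (metis of_nat_le_iff of_nat_mult)
    ultimately show ?thesis using V(1) by blast
  qed
  ultimately obtain c :: "(real \<times> real) set \<Rightarrow> nat" where
    c: "R \<noteq> {} \<Longrightarrow> real (card (c ` R)) \<le> 1 + ?L * ln (real (card R))"
      "\<And>e. e \<in> F \<Longrightarrow> card (e \<inter> R) \<le> k \<Longrightarrow> inj_on c (e \<inter> R)"
      "\<And>e. e \<in> F \<Longrightarrow> k \<le> card (e \<inter> R) \<Longrightarrow> k \<le> card (uniquely_coloured c (e \<inter> R)) + 1"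
    using ex_scf_coloring_of_classes[OF R(1), of ?L F k] by blast
  have eR: "e \<inter> R = e" if "e \<in> F" for e
    using that by (auto simp: F_def regions_at_def)
  have "scf_coloring (k - 1) (induced_hypergraph R) c"
    unfolding scf_coloring_def induced_hypergraph_def snd_conv F_def[symmetric]
  proof (intro conjI ballI impI)
    fix e assume e: "e \<in> F" and le: "k - 1 \<le> card e"
    show "k - 1 \<le> card (uniquely_coloured c e)"
    proof (cases "k \<le> card e")
      case True
      then show ?thesis using c(3)[OF e] eR[OF e] by simp
    next
      case False
      then have "inj_on c e" using c(2)[OF e] eR[OF e] by simp
      then have "uniquely_coloured c e = e"
        by (auto simp: uniquely_coloured_def inj_on_def)
      then show ?thesis using le by simp
    qed
  next
    fix e assume e: "e \<in> F" and "card e < k - 1"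
    then show "inj_on c e" using c(2)[OF e] eR[OF e] by simp
  qed
  then have "scf_number (induced_hypergraph R) (k - 1) \<le> card (c ` R)"
    unfolding scf_number_def by (intro Least_le) (auto simp: induced_hypergraph_def)
  also have "real (card (c ` R)) \<le> 1 + ?L * ln (real n)"
  proof -
    have "R \<noteq> {}" using R n by auto
    then show ?thesis using c(1) R by simp
  qed
  also have "\<dots> \<le> 1 + (9 * real k * (2 * log 2 (real n))) * log 2 (real n)"
  proof -
    have "ln (real n) \<le> log 2 (real n)"
      using n ln_2_less_1 by (simp add: log_def le_divide_eq mult_left_le)
    moreover have "?L \<le> 9 * real k * (2 * log 2 (real n))"
      using d k by (simp only: of_nat_mult) (intro mult_mono, auto)
    ultimately show ?thesis
      using n by (intro add_left_mono mult_mono) auto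
  qed
  also have "\<dots> \<le> 19 * real k * (log 2 (real n))\<^sup>2"
  proof -
    have "1 * 1 \<le> real k * (log 2 (real n))\<^sup>2"
      using k log1 by (intro mult_mono one_le_power) auto
    then show ?thesis by (simp add: power2_eq_square)
  qed
  finally show "real (scf_number (induced_hypergraph R) (k - 1)) \<le> 19 * real k * (log 2 (real n))\<^sup>2"
    by simp
qed

end
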